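(* For integers $0<q<p$ with $\gcd(p,q)=1$, it holds that $L(q,p-q)=\lceil\log_2(p)\rceil$.
   Context: $\lceil a\rceil$ is the least integer not smaller than $a$. For positive integers $s_1,\ldots,s_m$ put $\hat{s}=\sum_{i=1}^m s_i$. A simple second-order cone representation of size $n\ge 1$ of the weighted geometric mean inequality $x_1^{s_1}\cdots x_m^{s_m}\ge x_{m+1}^{\hat{s}}$ is a set of $n$ quadratic inequalities $x_{i_k}x_{j_k}\ge x_{m+k}^2$, $k=1,\ldots,n$, with $i_k,j_k\in\{1,2,\ldots,m+n\}$, such that for all nonnegative reals $x_1,\ldots,x_{m+1}$: $x_1^{s_1}\cdots x_m^{s_m}\ge x_{m+1}^{\hat{s}}$ holds if and only if there exist nonnegative reals $x_{m+2},\ldots,x_{m+n}$ (the $n-1$ auxiliary variables) with $x_{i_k}x_{j_k}\ge x_{m+k}^2$ for all $k=1,\ldots,n$. $L(s_1,\ldots,s_m)$ denotes the minimum size $n$ of a simple second-order cone representation of $x_1^{s_1}\cdots x_m^{s_m}\ge x_{m+1}^{\hat{s}}$. (Here $m=2$, $s_1=q$, $s_2=p-q$, $\hat{s}=p$.) *)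

theory Defs
  imports Complex_Main
begin

text \<open>
  A list \<open>s\<close> of weights stands for \<open>s\<^sub>1, \<dots>, s\<^sub>m\<close> with \<open>m = length s\<close>, so \<open>s\<^sub>l\<close> is \<open>s ! (l - 1)\<close>.
  A valuation \<open>x :: nat \<Rightarrow> real\<close> gives the values of the variables \<open>x\<^sub>1, x\<^sub>2, \<dots>\<close>; its values at
  indices that do not occur are irrelevant. The weights are intended to be positive.
\<close>

definition weighted_gm_ineq :: "nat list \<Rightarrow> (nat \<Rightarrow> real) \<Rightarrow> bool" where
  "weighted_gm_ineq s x \<longleftrightarrow>
     (\<Prod>l = 1..length s. x l ^ (s ! (l - 1))) \<ge> x (length s + 1) ^ sum_list s"

text \<open>
  The system of inequalities is indexed by \<open>k = 1, \<dots>, n\<close>, the \<open>k\<close>-th one being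
  \<open>x\<^bsub>i k\<^esub> x\<^bsub>j k\<^esub> \<ge> x\<^bsub>m+k\<^esub>\<^sup>2\<close>. The valuation \<open>y\<close> below extends the given values of
  \<open>x\<^sub>1, \<dots>, x\<^bsub>m+1\<^esub>\<close> by values for the auxiliary variables.
\<close>

definition simple_soc_rep :: "nat list \<Rightarrow> nat \<Rightarrow> (nat \<Rightarrow> nat) \<Rightarrow> (nat \<Rightarrow> nat) \<Rightarrow> bool" where
  "simple_soc_rep s n i j \<longleftrightarrow>
     (let m = length s in
        n \<ge> 1 \<and>
        (\<forall>k\<in>{1..n}. i k \<in> {1..m + n} \<and> j k \<in> {1..m + n}) \<and>
        (\<forall>x. (\<forall>l\<in>{1..m + 1}. x l \<ge> 0) \<longrightarrow>
           (weighted_gm_ineq s x \<longleftrightarrow>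
              (\<exists>y. (\<forall>l\<in>{1..m + 1}. y l = x l) \<and>
                   (\<forall>l\<in>{m + 2..m + n}. y l \<ge> 0) \<and>
                   (\<forall>k\<in>{1..n}. y (i k) * y (j k) \<ge> (y (m + k))\<^sup>2)))))"

definition L :: "nat list \<Rightarrow> nat" where
  "L s = (LEAST n. \<exists>i j. simple_soc_rep s n i j)"

end

theory Submission
  imports Defs "HOL-Library.Multiset"
begin

text \<open>
  Both halves of the proof show that a representation of size \<open>n\<close> exists if and only if
  \<open>n \<ge> 1\<close> and \<open>p \<le> 2 ^ n\<close>.

  If \<open>p \<le> 2 ^ n\<close>, multiply the inequality by \<open>x\<^sub>3 ^ (2 ^ n - p)\<close>. The target variable then
  appears on the left as well, and the three weights \<open>q\<close>, \<open>p - q\<close>, \<open>2 ^ n - p\<close> add up to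
  \<open>2 ^ n\<close>. They are not all even, so exactly two of them are odd. If these are \<open>a \<le> b\<close>, with
  variables \<open>u\<close> and \<open>v\<close>, a new variable for \<open>sqrt (u v)\<close> turns \<open>u ^ a v ^ b w ^ c\<close> into the
  square of a product with weights \<open>a\<close>, \<open>(b - a) / 2\<close>, \<open>c / 2\<close>. There are again three weights,
  their sum has been halved, and \<open>a\<close> is still odd. So \<open>n\<close> quadratic inequalities suffice
  (\<open>encodes_Suc\<close>, \<open>ex_encodes\<close>, \<open>ex_simple_soc_rep\<close>).

  For the lower bound, take logarithms. A quadratic inequality then says that a function is
  subharmonic at a vertex \<open>k\<close> of a directed graph in which \<open>k\<close> has the two successors
  \<open>i\<^sub>k\<close> and \<open>j\<^sub>k\<close>, and the vertices 1 and 2 are sinks. Only the part of the graph that is reachable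
  from vertex 3 matters, since all other auxiliary variables can be set to zero. On this part the
  representation says that the largest value at 3 of a subharmonic function with values 1
  and 0 at the sinks is \<open>q / p\<close>, and that it is attained. A function attaining it is harmonic
  (\<open>extremal_is_harmonic\<close>): slack anywhere could be used to raise the value at 3. Likewise a sink
  can be reached from every vertex (\<open>sinks_reachable\<close>).

  So \<open>q / p\<close> is the value at 3 of a harmonic function \<open>z\<close> with integral values at the sinks, and
  the denominator of such a value is at most \<open>2 ^ n\<close> (\<open>harmonic_denominator_le\<close>). The reason is
  chip firing. Put \<open>N\<close> chips on vertex 3, and as long as some vertex that is not a sink
  carries two chips, move one to each of its successors. This preserves the sum of \<open>z\<close> over the
  chips and ends with at most one chip on each of these vertices. Hence modulo 1 every multiple
  \<open>N q / p\<close> is the sum of \<open>z\<close> over one of at most \<open>2 ^ n\<close> sets of vertices. As \<open>p\<close> of these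
  multiples are distinct modulo 1, \<open>p \<le> 2 ^ n\<close>.
\<close>

section \<open>Weights with a power of two as sum\<close>

text \<open>
  The inequality \<open>F y \<ge> y\<^sub>3 ^ (2 ^ n)\<close> is the projection of a system of \<open>n\<close> quadratic
  inequalities, whose variables are those in \<open>U\<close>, the target 3 and the auxiliary variables
  \<open>4, \<dots>, n + 2\<close>. The set \<open>U\<close> may contain indices beyond \<open>n + 2\<close>: they are the
  auxiliary variables of a larger system that is being built on top of this one.
\<close>

definition encodes :: "nat \<Rightarrow> nat set \<Rightarrow> ((nat \<Rightarrow> real) \<Rightarrow> real) \<Rightarrow> (nat \<Rightarrow> nat) \<Rightarrow> (nat \<Rightarrow> nat) \<Rightarrow> bool" where
  "encodes n U F i j \<longleftrightarrow>
     (\<forall>k\<in>{1..n}. i k \<in> U \<union> {4..n+2} \<and> j k \<in> U \<union> {4..n+2}) \<and>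
     (\<forall>y. (\<forall>l. 0 \<le> y l) \<longrightarrow> (\<forall>k\<in>{1..n}. y (i k) * y (j k) \<ge> (y (2 + k))\<^sup>2) \<longrightarrow> y 3 ^ (2 ^ n) \<le> F y) \<and>
     (\<forall>x. (\<forall>l. 0 \<le> x l) \<longrightarrow> x 3 ^ (2 ^ n) \<le> F x \<longrightarrow>
        (\<exists>y. (\<forall>l. 0 \<le> y l) \<and> (\<forall>l. l \<notin> {4..n+2} \<longrightarrow> y l = x l) \<and>
             (\<forall>k\<in>{1..n}. y (i k) * y (j k) \<ge> (y (2 + k))\<^sup>2)))"

lemma encodes_one:
  "encodes 1 {u, v, w} (\<lambda>y. y u ^ 1 * y v ^ 1 * y w ^ 0) (\<lambda>_. u) (\<lambda>_. v)"
  unfolding encodes_def by (auto simp: eval_nat_numeral)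

lemma merged_square:
  fixes r s t :: real
  assumes "a \<le> b" "even (b - a)" "even c"
  shows "(r ^ a * s ^ ((b - a) div 2) * t ^ (c div 2))\<^sup>2 = (r\<^sup>2) ^ a * s ^ (b - a) * t ^ c"
  using assms by (simp add: power_mult_distrib flip: power_mult) (simp add: mult.commute)

lemma merged_product:
  fixes r s t :: real
  assumes "a \<le> b"
  shows "(r * s) ^ a * s ^ (b - a) * t ^ c = r ^ a * s ^ b * t ^ c"
  using assms by (simp add: power_mult_distrib mult.assoc flip: power_add)

text \<open>
  The halving step: the variable \<open>n + 3\<close> stands for the geometric mean of the variables \<open>u\<close> and
  \<open>v\<close>. The smaller of the two weights is moved completely to the mean, so there are still only
  three weights. The freshness condition ensures that the smaller system does not
  alter the values of \<open>u\<close>, \<open>v\<close> and \<open>w\<close>.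
\<close>

lemma encodes_Suc:
  assumes ab: "a \<le> b" "even (b - a)" "even c"
    and fresh: "{u, v, w} \<subseteq> {1..3} \<union> {n+4..}" and n: "n \<ge> 1"
    and enc: "encodes n {n+3, v, w} (\<lambda>y. y (n+3) ^ a * y v ^ ((b - a) div 2) * y w ^ (c div 2)) i j"
  shows "encodes (Suc n) {u, v, w} (\<lambda>y. y u ^ a * y v ^ b * y w ^ c) (i(Suc n := u)) (j(Suc n := v))"
proof -
  let ?G = "\<lambda>y::nat\<Rightarrow>real. y (n+3) ^ a * y v ^ ((b - a) div 2) * y w ^ (c div 2)"
  let ?F = "\<lambda>y::nat\<Rightarrow>real. y u ^ a * y v ^ b * y w ^ c"
  let ?i = "i(Suc n := u)" and ?j = "j(Suc n := v)"
  have sq: "(?G y)\<^sup>2 = ((y (n+3))\<^sup>2) ^ a * y v ^ (b - a) * y w ^ c" for y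
    by (rule merged_square[OF ab])
  have rng: "\<forall>k\<in>{1..Suc n}. ?i k \<in> {u,v,w} \<union> {4..Suc n+2} \<and> ?j k \<in> {u,v,w} \<union> {4..Suc n+2}"
  proof
    fix k assume "k \<in> {1..Suc n}"
    then consider "k = Suc n" | "k \<in> {1..n}" "k \<noteq> Suc n" by force
    then show "?i k \<in> {u,v,w} \<union> {4..Suc n+2} \<and> ?j k \<in> {u,v,w} \<union> {4..Suc n+2}"
    proof cases
      case 2
      then have "i k \<in> {n+3,v,w} \<union> {4..n+2}" "j k \<in> {n+3,v,w} \<union> {4..n+2}"
        using enc unfolding encodes_def by blast+
      then show ?thesis using 2 n by auto
    qed auto
  qed
  have sound: "y 3 ^ (2 ^ Suc n) \<le> ?F y"
    if pos: "\<forall>l. 0 \<le> y l" and sys: "\<forall>k\<in>{1..Suc n}. y (?i k) * y (?j k) \<ge> (y (2 + k))\<^sup>2" for y :: "nat \<Rightarrow> real"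
  proof -
    have "\<forall>k\<in>{1..n}. y (i k) * y (j k) \<ge> (y (2 + k))\<^sup>2"
    proof
      fix k assume "k \<in> {1..n}"
      then show "y (i k) * y (j k) \<ge> (y (2 + k))\<^sup>2" using sys[rule_format, of k] by (auto split: if_splits)
    qed
    then have "y 3 ^ (2 ^ n) \<le> ?G y" using enc pos unfolding encodes_def by blast
    then have "(y 3 ^ (2 ^ n))\<^sup>2 \<le> (?G y)\<^sup>2" using pos by (intro power_mono) auto
    also have "\<dots> \<le> (y u * y v) ^ a * y v ^ (b - a) * y w ^ c"
      unfolding sq using sys[rule_format, of "Suc n"] pos
      by (intro mult_right_mono power_mono) (auto simp: add.commute eval_nat_numeral)
    also have "\<dots> = ?F y" by (rule merged_product[OF ab(1)])
    finally show ?thesis by (simp add: mult.commute flip: power_mult)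
  qed
  have complete: "\<exists>y. (\<forall>l. 0 \<le> y l) \<and> (\<forall>l. l \<notin> {4..Suc n+2} \<longrightarrow> y l = x l) \<and>
             (\<forall>k\<in>{1..Suc n}. y (?i k) * y (?j k) \<ge> (y (2 + k))\<^sup>2)"
    if pos: "\<forall>l. 0 \<le> x l" and ge: "x 3 ^ (2 ^ Suc n) \<le> ?F x" for x :: "nat \<Rightarrow> real"
  proof -
    define x' where "x' = x(n+3 := sqrt (x u * x v))"
    have pos': "\<forall>l. 0 \<le> x' l" using pos by (simp add: x'_def)
    have keep: "x' v = x v" "x' w = x w" "x' u = x u" "x' 3 = x 3" using fresh n by (auto simp: x'_def)
    have "(x' (n+3))\<^sup>2 = x u * x v" using pos by (simp add: x'_def)
    then have "(?G x')\<^sup>2 = ?F x" using sq[of x'] keep by (simp add: merged_product[OF ab(1)])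
    then have "(x' 3 ^ (2 ^ n))\<^sup>2 \<le> (?G x')\<^sup>2" using ge keep by (simp add: mult.commute flip: power_mult)
    then have "x' 3 ^ (2 ^ n) \<le> ?G x'" by (rule power2_le_imp_le) (use pos' in auto)
    then obtain y where y: "\<forall>l. 0 \<le> y l" "\<forall>l. l \<notin> {4..n+2} \<longrightarrow> y l = x' l"
        "\<forall>k\<in>{1..n}. y (i k) * y (j k) \<ge> (y (2 + k))\<^sup>2"
      using enc pos' unfolding encodes_def by blast
    have top: "y (n+3) = sqrt (x u * x v)" "y u = x u" "y v = x v"
      using y(2) fresh keep by (auto simp: x'_def)
    have "y (?i k) * y (?j k) \<ge> (y (2 + k))\<^sup>2" if "k \<in> {1..Suc n}" for k
    proof (cases "k = Suc n")
      case True
      then show ?thesis using top pos by (simp add: eval_nat_numeral)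
    next
      case False
      then show ?thesis using y(3) that by auto
    qed
    moreover have "\<forall>l. l \<notin> {4..Suc n+2} \<longrightarrow> y l = x l" using y(2) n by (auto simp: x'_def)
    ultimately show ?thesis using y(1) by blast
  qed
  show ?thesis unfolding encodes_def using rng sound complete by blast
qed

lemma pair_odd_weights:
  fixes a b c :: nat
  assumes "even (a + b + c)" "odd a \<or> odd b \<or> odd c"
  obtains a' b' c' u' v' w' where "odd a'" "odd b'" "a' \<le> b'" "even c'" "a' + b' + c' = a + b + c"
    "{u', v', w'} = {u, v, w}"
    "\<And>y :: nat \<Rightarrow> real. y u' ^ a' * y v' ^ b' * y w' ^ c' = y u ^ a * y v ^ b * y w ^ c"
proof -
  consider "odd a" "odd b" "even c" | "odd a" "odd c" "even b" | "odd b" "odd c" "even a"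
    using assms by auto
  then show thesis
  proof cases
    case 1
    show thesis
    proof (cases "a \<le> b")
      case True then show thesis using 1 by (intro that[of a b c u v w]) auto
    next
      case False then show thesis using 1 by (intro that[of b a c v u w]) (auto simp: mult_ac)
    qed
  next
    case 2
    show thesis
    proof (cases "a \<le> c")
      case True then show thesis using 2 by (intro that[of a c b u w v]) (auto simp: mult_ac)
    next
      case False then show thesis using 2 by (intro that[of c a b w u v]) (auto simp: mult_ac)
    qed
  next
    case 3
    show thesis
    proof (cases "b \<le> c")
      case True then show thesis using 3 by (intro that[of b c a v w u]) (auto simp: mult_ac)
    next
      case False then show thesis using 3 by (intro that[of c b a w v u]) (auto simp: mult_ac)
    qed
  qed
qed

text \<open>
  Halving can be repeated until the sum of the weights is 2, because one of the merged weights
  stays as it is and is odd. The two odd weights are then both 1, and the last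
  inequality defines the target.
\<close>

lemma ex_encodes:
  assumes "n \<ge> 1" "a + b + c = 2 ^ n" "odd a \<or> odd b \<or> odd c"
    "{u, v, w} \<subseteq> {1..3} \<union> {n+3..}"
  shows "\<exists>i j. encodes n {u, v, w} (\<lambda>y. y u ^ a * y v ^ b * y w ^ c) i j"
  using assms
proof (induction n arbitrary: a b c u v w rule: nat_induct_at_least)
  case base
  then have "even (a + b + c)" by simp
  then obtain a' b' c' u' v' w' where *: "odd a'" "odd b'" "a' \<le> b'" "even c'" "a' + b' + c' = a + b + c"
    "{u', v', w'} = {u, v, w}"
    "\<And>y :: nat \<Rightarrow> real. y u' ^ a' * y v' ^ b' * y w' ^ c' = y u ^ a * y v ^ b * y w ^ c"
    using pair_odd_weights[of a b c u v w] base(2) by blast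
  have "a' = 1" "b' = 1" "c' = 0" using *(1,2,5) base by (auto elim!: oddE)
  then show ?case using encodes_one[of u' v' w'] *(6,7) by auto
next
  case (Suc n)
  then have "even (a + b + c)" by simp
  then obtain a' b' c' u' v' w' where *: "odd a'" "odd b'" "a' \<le> b'" "even c'" "a' + b' + c' = a + b + c"
    "{u', v', w'} = {u, v, w}"
    "\<And>y :: nat \<Rightarrow> real. y u' ^ a' * y v' ^ b' * y w' ^ c' = y u ^ a * y v ^ b * y w ^ c"
    using pair_odd_weights[of a b c u v w] Suc.prems(2) by blast
  have ev: "even (b' - a')" using * by auto
  have "2 * (a' + (b' - a') div 2 + c' div 2) = 2 * 2 ^ n"
    using * ev Suc.prems(1) by (auto elim!: evenE)
  then have sum: "a' + (b' - a') div 2 + c' div 2 = 2 ^ n" by simp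
  have sub: "{u', v', w'} \<subseteq> {1..3} \<union> {n+4..}" using *(6) Suc.prems(3) by auto
  then have "{n+3, v', w'} \<subseteq> {1..3} \<union> {n+3..}" by auto
  then obtain i j where "encodes n {n+3, v', w'} (\<lambda>y. y (n+3) ^ a' * y v' ^ ((b' - a') div 2) * y w' ^ (c' div 2)) i j"
    using Suc.IH[OF sum] *(1) by blast
  from encodes_Suc[OF *(3) ev *(4) sub Suc.hyps(1) this] show ?case
    unfolding *(6,7) by blast
qed

lemma simple_soc_rep_pair:
  "simple_soc_rep [s, t] n i j \<longleftrightarrow>
     n \<ge> 1 \<and> (\<forall>k\<in>{1..n}. i k \<in> {1..n+2} \<and> j k \<in> {1..n+2}) \<and>
     (\<forall>x :: nat \<Rightarrow> real. (\<forall>l\<in>{1..3}. x l \<ge> 0) \<longrightarrow>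
        (x 1 ^ s * x 2 ^ t \<ge> x 3 ^ (s + t) \<longleftrightarrow>
           (\<exists>y. (\<forall>l\<in>{1..3}. y l = x l) \<and> (\<forall>l\<in>{4..n+2}. y l \<ge> 0) \<and>
                (\<forall>k\<in>{1..n}. y (i k) * y (j k) \<ge> (y (2 + k))\<^sup>2))))"
proof -
  have "length [s, t] = 2" "(2::nat) + 1 = 3" "(2::nat) + 2 = 4" "2 + n = n + 2" by simp_all
  note * = this
  have "weighted_gm_ineq [s, t] x \<longleftrightarrow> x 1 ^ s * x 2 ^ t \<ge> x 3 ^ (s + t)" for x
    by (simp add: weighted_gm_ineq_def eval_nat_numeral)
  then show ?thesis unfolding simple_soc_rep_def Let_def * by (simp only:)
qed

lemma ex_simple_soc_rep:
  assumes "0 < q" "q < p" "gcd p q = 1" "n \<ge> 1" "p \<le> 2 ^ n"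
  shows "\<exists>i j. simple_soc_rep [q, p - q] n i j"
proof -
  have "q + (p - q) + (2 ^ n - p) = 2 ^ n" using assms by simp
  moreover have "odd q \<or> odd (p - q) \<or> odd (2 ^ n - p)"
  proof (rule ccontr)
    assume "\<not> ?thesis"
    then have "even q" "even (q + (p - q))" by simp_all
    then have "even q" "even p" using assms(2) by simp_all
    then have "2 dvd gcd p q" by (intro gcd_greatest)
    then show False using assms(3) by simp
  qed
  ultimately obtain i j where enc:
    "encodes n {1, 2, 3} (\<lambda>y. y 1 ^ q * y 2 ^ (p - q) * y 3 ^ (2 ^ n - p)) i j"
    using ex_encodes[OF assms(4), of q "p - q" "2 ^ n - p" 1 2 3] by auto
  let ?F = "\<lambda>y::nat\<Rightarrow>real. y 1 ^ q * y 2 ^ (p - q) * y 3 ^ (2 ^ n - p)"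
  have split: "t ^ (2 ^ n) = t ^ p * t ^ (2 ^ n - p)" for t :: real
    using assms(5) by (simp flip: power_add)
  \<comment> \<open>Where \<open>y 3 = 0\<close>, cancelling the extra factor fails, but both sides hold trivially.\<close>
  have iff: "y 3 ^ (2 ^ n) \<le> ?F y \<longleftrightarrow> y 3 ^ (q + (p - q)) \<le> y 1 ^ q * y 2 ^ (p - q)"
    if "\<forall>l. 0 \<le> y l" for y
  proof (cases "y 3 = 0")
    case True
    then show ?thesis using that assms(1,2) by (simp add: power_0_left)
  next
    case False
    then have "0 < y 3" using that by (simp add: order_less_le)
    then show ?thesis using assms(2) unfolding split by simp
  qed
  have rng: "i k \<in> {1..n+2} \<and> j k \<in> {1..n+2}" if "k \<in> {1..n}" for k
  proof -
    have "i k \<in> {1,2,3} \<union> {4..n+2} \<and> j k \<in> {1,2,3} \<union> {4..n+2}"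
      using enc that unfolding encodes_def by blast
    then show ?thesis using assms(4) by auto
  qed
  have "x 3 ^ (q + (p - q)) \<le> x 1 ^ q * x 2 ^ (p - q) \<longleftrightarrow>
      (\<exists>y. (\<forall>l\<in>{1..3}. y l = x l) \<and> (\<forall>l\<in>{4..n+2}. y l \<ge> 0) \<and>
           (\<forall>k\<in>{1..n}. y (i k) * y (j k) \<ge> (y (2 + k))\<^sup>2))" (is "?L \<longleftrightarrow> ?R")
    if x: "\<forall>l\<in>{1..3}. 0 \<le> x l" for x :: "nat \<Rightarrow> real"
  proof
    assume gm: ?L
    define x' where "x' = (\<lambda>l. \<bar>x l\<bar>)"
    have x'_eq: "x' l = x l" if "l \<in> {1..3}" for l using x that by (simp add: x'_def)
    have x'_nonneg: "\<forall>l. 0 \<le> x' l" by (simp add: x'_def)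
    have "x' 3 ^ (2 ^ n) \<le> ?F x'" using iff[OF x'_nonneg] gm x'_eq by simp
    then obtain y where y: "\<forall>l. 0 \<le> y l" "\<forall>l. l \<notin> {4..n+2} \<longrightarrow> y l = x' l"
      "\<forall>k\<in>{1..n}. y (i k) * y (j k) \<ge> (y (2 + k))\<^sup>2"
      using enc x'_nonneg unfolding encodes_def by blast
    have "\<forall>l\<in>{1..3}. y l = x l" using y(2) x'_eq by auto
    then show ?R using y by blast
  next
    assume ?R
    then obtain y where y: "\<forall>l\<in>{1..3}. y l = x l" "\<forall>l\<in>{4..n+2}. 0 \<le> y l"
      "\<forall>k\<in>{1..n}. y (i k) * y (j k) \<ge> (y (2 + k))\<^sup>2" by blast
    define y' where "y' = (\<lambda>l. \<bar>y l\<bar>)"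
    have y'_eq: "y' l = y l" if "l \<in> {1..n+2}" for l
    proof (cases "l \<le> 3")
      case True then show ?thesis using y(1) x that by (simp add: y'_def)
    next
      case False then show ?thesis using y(2) that by (simp add: y'_def)
    qed
    have y'_nonneg: "\<forall>l. 0 \<le> y' l" by (simp add: y'_def)
    have "y' (i k) * y' (j k) \<ge> (y' (2 + k))\<^sup>2" if "k \<in> {1..n}" for k
      using y(3) that y'_eq rng[OF that] by simp
    then have "y' 3 ^ (2 ^ n) \<le> ?F y'" using enc y'_nonneg unfolding encodes_def by blast
    moreover have "y' 1 = x 1" "y' 2 = x 2" "y' 3 = x 3" using y'_eq y(1) assms(4) by auto
    ultimately show ?L using iff[OF y'_nonneg] by simp
  qed
  then have "simple_soc_rep [q, p - q] n i j"
    unfolding simple_soc_rep_pair using assms(4) rng by blast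
  then show ?thesis by blast
qed

section \<open>Functions decaying with the distance to a set\<close>

text \<open>
  The value at \<open>k\<close> is \<open>2 ^ (- d)\<close>, where \<open>d\<close> is the distance from \<open>k\<close> to \<open>T\<close>, and 0 at
  infinite distance. In a graph with two successors for each vertex, such a function is
  subharmonic off \<open>T\<close>: the successor on a shortest path alone has twice the value at \<open>k\<close>.
\<close>

definition decay :: "('v \<times> 'v) set \<Rightarrow> 'v set \<Rightarrow> 'v \<Rightarrow> real" where
  "decay E T k = (if \<exists>t\<in>T. (k, t) \<in> E\<^sup>* then (1/2) ^ (LEAST d. \<exists>t\<in>T. (k, t) \<in> E ^^ d) else 0)"

lemma decay_pos_iff: "0 < decay E T k \<longleftrightarrow> (\<exists>t\<in>T. (k, t) \<in> E\<^sup>*)"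
  by (simp add: decay_def)

lemma decay_nonneg: "0 \<le> decay E T k"
  by (simp add: decay_def)

lemma decay_le_1: "decay E T k \<le> 1"
  by (simp add: decay_def power_le_one)

lemma decay_eq_1: "k \<in> T \<Longrightarrow> decay E T k = 1"
  unfolding decay_def by (subst Least_equality[of _ 0]) auto

lemma decay_eq_0_sink:
  assumes "k \<notin> T" "\<And>l. (k, l) \<notin> E"
  shows "decay E T k = 0"
  using assms unfolding decay_def by (metis converse_rtranclE)

lemma decay_step:
  assumes "k \<notin> T" "\<exists>t\<in>T. (k, t) \<in> E\<^sup>*"
  shows "\<exists>l. (k, l) \<in> E \<and> 2 * decay E T k \<le> decay E T l"
proof -
  define P where "P l d \<longleftrightarrow> (\<exists>t\<in>T. (l, t) \<in> E ^^ d)" for l d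
  have dec: "decay E T l = (1/2) ^ (LEAST d. P l d)" if "P l d" for l d
    using that unfolding decay_def P_def by (auto simp: rtrancl_power)
  obtain d0 where "P k d0" using assms(2) unfolding P_def by (auto simp: rtrancl_power)
  then have min: "P k (LEAST d. P k d)" by (rule LeastI)
  have "\<not> P k 0" using assms(1) by (auto simp: P_def)
  then obtain d where d: "(LEAST d. P k d) = Suc d" using min by (metis not0_implies_Suc)
  with min obtain t where "t \<in> T" "(k, t) \<in> E ^^ Suc d" by (auto simp: P_def)
  then obtain l where l: "(k, l) \<in> E" "P l d" unfolding P_def by (meson relpow_Suc_D2)
  have "(LEAST d. P l d) \<le> d" using l(2) by (rule Least_le)
  then have "(1/2::real) ^ d \<le> (1/2) ^ (LEAST d. P l d)" by (intro power_decreasing) auto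
  then have "2 * decay E T k \<le> decay E T l"
    unfolding dec[OF l(2)] dec[OF \<open>P k d0\<close>] d by simp
  then show ?thesis using l(1) by blast
qed

section \<open>Averaging systems\<close>

definition steps :: "'v set \<Rightarrow> ('v \<Rightarrow> 'v) \<Rightarrow> ('v \<Rightarrow> 'v) \<Rightarrow> ('v \<times> 'v) set" where
  "steps V a b = {(k, l). k \<in> V \<and> (l = a k \<or> l = b k)}"

definition subharmonic :: "'v set \<Rightarrow> ('v \<Rightarrow> 'v) \<Rightarrow> ('v \<Rightarrow> 'v) \<Rightarrow> ('v \<Rightarrow> real) \<Rightarrow> bool" where
  "subharmonic V a b z \<longleftrightarrow> (\<forall>k\<in>V. 2 * z k \<le> z (a k) + z (b k))"

lemma decay_subharmonic:
  assumes "k \<in> V" "k \<notin> T"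
  shows "2 * decay (steps V a b) T k \<le> decay (steps V a b) T (a k) + decay (steps V a b) T (b k)"
proof (cases "\<exists>t\<in>T. (k, t) \<in> (steps V a b)\<^sup>*")
  case True
  from decay_step[OF assms(2) this] show ?thesis
    using decay_nonneg[of "steps V a b" T "a k"] decay_nonneg[of "steps V a b" T "b k"]
    by (auto simp: steps_def)
next
  case False
  then have "decay (steps V a b) T k = 0" by (simp add: decay_def)
  then show ?thesis by (simp add: add_nonneg_nonneg decay_nonneg)
qed

lemma decay_strictly_subharmonic:
  assumes "k \<in> V" "k \<notin> T" "\<exists>t\<in>T. (k, t) \<in> (steps V a b)\<^sup>*"
    "\<exists>t\<in>T. (a k, t) \<in> (steps V a b)\<^sup>*" "\<exists>t\<in>T. (b k, t) \<in> (steps V a b)\<^sup>*"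
  shows "2 * decay (steps V a b) T k < decay (steps V a b) T (a k) + decay (steps V a b) T (b k)"
  using decay_step[OF assms(2,3)] assms(4,5)[folded decay_pos_iff]
  by (auto simp: steps_def)

text \<open>
  The vertices that can be reached from a vertex \<open>k\<close> form a set \<open>T\<close> closed under successors. If it
  contained no sink, the decay from \<open>T\<close> would be subharmonic on \<open>T\<close> too, where it is constantly 1. It would
  vanish at the sinks and be positive at the root, contradicting the bound.
\<close>

lemma sinks_reachable:
  assumes root: "\<And>k. k \<in> V \<Longrightarrow> (r, k) \<in> (steps V a b)\<^sup>*"
    and sinks: "S \<inter> V = {}"
    and bound: "\<And>z. subharmonic V a b z \<Longrightarrow> (\<forall>s\<in>S. z s = 0) \<Longrightarrow> z r \<le> 0"
    and k: "k \<in> V"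
  shows "\<exists>s\<in>S. (k, s) \<in> (steps V a b)\<^sup>*"
proof (rule ccontr)
  let ?E = "steps V a b"
  assume no: "\<not> (\<exists>s\<in>S. (k, s) \<in> ?E\<^sup>*)"
  define T where "T = {l. (k, l) \<in> ?E\<^sup>*}"
  have T_closed: "a l \<in> T \<and> b l \<in> T" if "l \<in> T" "l \<in> V" for l
    using that unfolding T_def by (auto intro: rtrancl_into_rtrancl simp: steps_def)
  have "subharmonic V a b (decay ?E T)"
    unfolding subharmonic_def
  proof
    fix l assume l: "l \<in> V"
    show "2 * decay ?E T l \<le> decay ?E T (a l) + decay ?E T (b l)"
    proof (cases "l \<in> T")
      case True
      then show ?thesis using T_closed[OF True l] by (simp add: decay_eq_1)
    next
      case False
      then show ?thesis using decay_subharmonic[OF l False] by simp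
    qed
  qed
  moreover have "\<forall>s\<in>S. decay ?E T s = 0"
    using no sinks by (auto intro!: decay_eq_0_sink simp: T_def steps_def)
  ultimately have "decay ?E T r \<le> 0" by (rule bound)
  moreover have "0 < decay ?E T r" unfolding decay_pos_iff using root[OF k] by (auto simp: T_def)
  ultimately show False by simp
qed

text \<open>
  Slack at \<open>k\<close> leaves room for adding to \<open>z\<close> a small multiple of the decay from \<open>{k}\<close>, which violates
  subharmonicity at \<open>k\<close> only. This raises the value at the root without changing the
  values at the sinks.
\<close>

lemma extremal_is_harmonic:
  assumes root: "\<And>k. k \<in> V \<Longrightarrow> (r, k) \<in> (steps V a b)\<^sup>*"
    and sinks: "S \<inter> V = {}"
    and z: "subharmonic V a b z"
    and extremal: "\<And>z'. subharmonic V a b z' \<Longrightarrow> (\<forall>s\<in>S. z' s = z s) \<Longrightarrow> z' r \<le> z r"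
    and k: "k \<in> V"
  shows "2 * z k = z (a k) + z (b k)"
proof (rule ccontr)
  let ?E = "steps V a b"
  assume "2 * z k \<noteq> z (a k) + z (b k)"
  then have slack: "2 * z k < z (a k) + z (b k)" using z k by (force simp: subharmonic_def)
  \<comment> \<open>At \<open>k\<close> the decay is 1, so raising \<open>z k\<close> by half the slack uses up all of it.\<close>
  define e where "e = (z (a k) + z (b k) - 2 * z k) / 2"
  have e: "e > 0" using slack by (simp add: e_def)
  define z' where "z' l = z l + e * decay ?E {k} l" for l
  have "subharmonic V a b z'"
    unfolding subharmonic_def
  proof
    fix l assume l: "l \<in> V"
    show "2 * z' l \<le> z' (a l) + z' (b l)"
    proof (cases "l = k")
      case True
      have "2 * z' k = z (a k) + z (b k)" by (simp add: z'_def decay_eq_1 e_def field_simps)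
      also have "\<dots> \<le> z' (a k) + z' (b k)"
        using e by (simp add: z'_def decay_nonneg)
      finally show ?thesis using True by simp
    next
      case False
      then have "e * (2 * decay ?E {k} l) \<le> e * (decay ?E {k} (a l) + decay ?E {k} (b l))"
        using e l by (intro mult_left_mono decay_subharmonic) auto
      moreover have "2 * z l \<le> z (a l) + z (b l)" using z l by (simp add: subharmonic_def)
      ultimately show ?thesis by (simp add: z'_def algebra_simps)
    qed
  qed
  moreover have "decay ?E {k} s = 0" if "s \<in> S" for s
    using that sinks k by (intro decay_eq_0_sink) (auto simp: steps_def)
  then have "\<forall>s\<in>S. z' s = z s" by (simp add: z'_def)
  ultimately have "z' r \<le> z r" by (rule extremal)
  moreover have "0 < decay ?E {k} r" unfolding decay_pos_iff using root[OF k] by simp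
  ultimately show False using e by (simp add: z'_def mult_le_0_iff)
qed

section \<open>Chip firing\<close>

text \<open>
  A multiset of vertices is a configuration of chips. Firing a vertex of \<open>V\<close> with at least two
  chips preserves the sum of the harmonic function \<open>z\<close> and lowers that of the strictly
  superharmonic function \<open>h\<close>. As \<open>V\<close> is finite, it lowers it by at least a fixed amount \<open>e\<close>, so
  the process ends.
\<close>

lemma chip_firing_stabilizes:
  fixes z h :: "'v \<Rightarrow> real" and M :: "'v multiset"
  assumes fin: "finite V"
    and closed: "\<And>k. k \<in> V \<Longrightarrow> {a k, b k} \<subseteq> V \<union> S"
    and harm: "\<And>k. k \<in> V \<Longrightarrow> 2 * z k = z (a k) + z (b k)"
    and h0: "\<And>k. 0 \<le> h k"
    and h: "\<And>k. k \<in> V \<Longrightarrow> h (a k) + h (b k) < 2 * h k"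
    and M: "set_mset M \<subseteq> V \<union> S"
  shows "\<exists>M'. set_mset M' \<subseteq> V \<union> S \<and> (\<forall>k\<in>V. count M' k \<le> 1) \<and>
              (\<Sum>x\<in>#M'. z x) = (\<Sum>x\<in>#M. z x)"
proof -
  obtain e where e: "e > 0" "\<And>k. k \<in> V \<Longrightarrow> e \<le> 2 * h k - (h (a k) + h (b k))"
  proof
    let ?A = "insert 1 ((\<lambda>k. 2 * h k - (h (a k) + h (b k))) ` V)"
    show "Min ?A > 0" using fin h by (subst Min_gr_iff) auto
    show "Min ?A \<le> 2 * h k - (h (a k) + h (b k))" if "k \<in> V" for k
      using fin that by (intro Min_le) auto
  qed
  define pot where "pot M = (\<Sum>x\<in>#M. h x)" for M
  have pot0: "0 \<le> pot M" for M unfolding pot_def by (induction M) (auto simp: h0)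
  show ?thesis using M
  proof (induction "nat \<lfloor>pot M / e\<rfloor>" arbitrary: M rule: less_induct)
    case less
    show ?case
    proof (cases "\<forall>k\<in>V. count M k \<le> 1")
      case True
      then show ?thesis using less.prems by blast
    next
      case False
      then obtain k where k: "k \<in> V" "count M k \<ge> 2" by force
      then have "replicate_mset 2 k \<subseteq># M" by (simp add: count_le_replicate_mset_subset_eq)
      then obtain N where N: "M = {#k, k#} + N" by (metis mset_subset_eq_exists_conv numeral_2_eq_2 replicate_mset_0 replicate_mset_Suc)
      define M1 where "M1 = {#a k, b k#} + N"
      have "pot M1 \<le> pot M - e" using e(2)[OF k(1)] by (simp add: pot_def M1_def N)
      then have "pot M1 / e \<le> pot M / e - 1" using e(1) by (simp add: field_simps)
      then have "\<lfloor>pot M1 / e\<rfloor> < \<lfloor>pot M / e\<rfloor>" by linarith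
      moreover have "0 \<le> \<lfloor>pot M1 / e\<rfloor>" using pot0[of M1] e(1) by simp
      ultimately have "nat \<lfloor>pot M1 / e\<rfloor> < nat \<lfloor>pot M / e\<rfloor>" by linarith
      moreover have "set_mset M1 \<subseteq> V \<union> S" using less.prems closed[OF k(1)] by (auto simp: M1_def N)
      ultimately obtain M' where "set_mset M' \<subseteq> V \<union> S" "\<forall>k\<in>V. count M' k \<le> 1"
          "(\<Sum>x\<in>#M'. z x) = (\<Sum>x\<in>#M1. z x)"
        using less.hyps by blast
      moreover have "(\<Sum>x\<in>#M1. z x) = (\<Sum>x\<in>#M. z x)" using harm[OF k(1)] by (simp add: M1_def N)
      ultimately show ?thesis by auto
    qed
  qed
qed

lemma stable_sum:
  fixes z :: "'v \<Rightarrow> real"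
  assumes "finite V" "set_mset M \<subseteq> V \<union> S" "\<forall>k\<in>V. count M k \<le> 1" "\<And>s. s \<in> S \<Longrightarrow> z s \<in> \<int>"
  shows "(\<Sum>x\<in>#M. z x) - (\<Sum>x\<in>set_mset M \<inter> V. z x) \<in> \<int>"
proof -
  have "filter_mset (\<lambda>x. x \<in> V) M = mset_set (set_mset M \<inter> V)"
  proof (rule multiset_eqI)
    fix x
    show "count (filter_mset (\<lambda>x. x \<in> V) M) x = count (mset_set (set_mset M \<inter> V)) x"
    proof (cases "x \<in> set_mset M \<inter> V")
      case True
      then have "count M x \<le> 1" "0 < count M x" using assms(3) by simp_all
      then have "count M x = 1" by linarith
      then show ?thesis using True by (simp add: count_mset_set)
    next
      case False
      then show ?thesis by (auto simp: count_mset_set' count_eq_zero_iff)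
    qed
  qed
  then have "(\<Sum>x\<in>#filter_mset (\<lambda>x. x \<in> V) M. z x) = (\<Sum>x\<in>set_mset M \<inter> V. z x)"
    by (simp add: sum_unfold_sum_mset)
  moreover have "(\<Sum>x\<in>#M. z x) = (\<Sum>x\<in>#filter_mset (\<lambda>x. x \<in> V) M. z x) + (\<Sum>x\<in>#filter_mset (\<lambda>x. x \<notin> V) M. z x)"
    by (metis image_mset_union multiset_partition sum_mset.union)
  moreover have "(\<Sum>x\<in>#N. z x) \<in> \<int>" if "set_mset N \<subseteq> S" for N
    using that assms(4) by (induction N) auto
  then have "(\<Sum>x\<in>#filter_mset (\<lambda>x. x \<notin> V) M. z x) \<in> \<int>"
    by this (use assms(2) in auto)
  ultimately show ?thesis by simp
qed

text \<open>
  The chips on sinks contribute integers, so modulo 1 the multiples of \<open>z r\<close> are sums of \<open>z\<close> over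
  subsets of \<open>V\<close>. Firing ends because every vertex can reach a sink, which makes the decay
  from the sinks strictly subharmonic.
\<close>

lemma harmonic_denominator_le:
  fixes z :: "'v \<Rightarrow> real" and p q :: nat
  assumes fin: "finite V" and r: "r \<in> V"
    and closed: "\<And>k. k \<in> V \<Longrightarrow> {a k, b k} \<subseteq> V \<union> S"
    and harm: "\<And>k. k \<in> V \<Longrightarrow> 2 * z k = z (a k) + z (b k)"
    and reach: "\<And>k. k \<in> V \<Longrightarrow> \<exists>s\<in>S. (k, s) \<in> (steps V a b)\<^sup>*"
    and sinks: "S \<inter> V = {}" "\<And>s. s \<in> S \<Longrightarrow> z s \<in> \<int>"
    and zr: "z r = real q / real p" and p: "p > 0" "coprime p q"
  shows "p \<le> 2 ^ card V"
proof -
  let ?E = "steps V a b"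
  define h where "h k = 1 - decay ?E S k" for k
  have h0: "0 \<le> h k" for k by (simp add: h_def decay_le_1)
  have reach': "\<exists>s\<in>S. (k, s) \<in> ?E\<^sup>*" if "k \<in> V \<union> S" for k
    using that reach by blast
  have h: "h (a k) + h (b k) < 2 * h k" if k: "k \<in> V" for k
  proof -
    have "2 * decay ?E S k < decay ?E S (a k) + decay ?E S (b k)"
      using closed[OF k] k sinks by (intro decay_strictly_subharmonic reach') auto
    then show ?thesis by (simp add: h_def)
  qed
  have "\<exists>A. A \<subseteq> V \<and> real N * (q / p) - sum z A \<in> \<int>" for N
  proof -
    have "set_mset (replicate_mset N r) \<subseteq> V \<union> S" using r by auto
    from chip_firing_stabilizes[where h = h and z = z, OF fin closed harm h0 h this]
    obtain M where M: "set_mset M \<subseteq> V \<union> S" "\<forall>k\<in>V. count M k \<le> 1"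
        "(\<Sum>x\<in>#M. z x) = (\<Sum>x\<in>#replicate_mset N r. z x)"
      by blast
    then show ?thesis using stable_sum[OF fin M(1,2), of z] sinks zr by auto
  qed
  then obtain A where A: "\<And>N. A N \<subseteq> V" "\<And>N. real N * (q / p) - sum z (A N) \<in> \<int>" by metis
  have "inj_on A {0..<p}"
  proof
    fix m n assume mn: "m \<in> {0..<p}" "n \<in> {0..<p}" "A m = A n"
    have "(real m * (q / p) - sum z (A m)) - (real n * (q / p) - sum z (A n)) \<in> \<int>"
      using Ints_diff[OF A(2)[of m] A(2)[of n]] .
    then obtain c where "(real m * (q / p) - sum z (A m)) - (real n * (q / p) - sum z (A n)) = of_int c"
      by (auto elim: Ints_cases)
    then have "(real m - real n) * q = of_int c * p" using mn(3) p by (simp add: field_simps)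
    then have "real_of_int ((int m - int n) * int q) = real_of_int (c * int p)" by simp
    then have "(int m - int n) * int q = c * int p" by (rule of_int_eq_iff[THEN iffD1])
    then have "int p dvd (int m - int n) * int q" by simp
    then have "int p dvd int m - int n" using p(2) by (simp add: coprime_dvd_mult_left_iff)
    moreover have "\<bar>int m - int n\<bar> < int p" using mn(1,2) by auto
    ultimately show "m = n" using dvd_imp_le_int[of "int m - int n" "int p"] by fastforce
  qed
  then have "card {0..<p} \<le> card (Pow V)" using A(1) fin by (intro card_inj_on_le[of A]) auto
  then show ?thesis using fin by (simp add: card_Pow)
qed

section \<open>The logarithm of a representation\<close>

text \<open>
  The exponential and the logarithm pass between subharmonic functions on the part \<open>V\<close> reachable
  from 3 and solutions of the quadratic system. In one direction, the variables outside \<open>V\<close> and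
  the sinks are set to 0, which satisfies the inequalities that define them. In the
  other direction, a solution with positive target is positive on all of \<open>V\<close>, because positivity
  passes from a vertex to both of its successors.
\<close>

lemma simple_soc_rep_size:
  assumes "0 < q" "q < p" "gcd p q = 1" and rep: "simple_soc_rep [q, p - q] n i j"
  shows "p \<le> 2 ^ n"
proof -
  have sum: "q + (p - q) = p" using assms(2) by simp
  have n: "n \<ge> 1" and rng: "\<And>k. k \<in> {1..n} \<Longrightarrow> i k \<in> {1..n+2} \<and> j k \<in> {1..n+2}"
    and iff: "\<And>x :: nat \<Rightarrow> real. \<forall>l\<in>{1..3}. x l \<ge> 0 \<Longrightarrow> x 1 ^ q * x 2 ^ (p - q) \<ge> x 3 ^ p \<longleftrightarrow>
       (\<exists>y. (\<forall>l\<in>{1..3}. y l = x l) \<and> (\<forall>l\<in>{4..n+2}. y l \<ge> 0) \<and>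
            (\<forall>k\<in>{1..n}. y (i k) * y (j k) \<ge> (y (2 + k))\<^sup>2))"
    using rep unfolding simple_soc_rep_pair sum by blast+
  define a where "a l = i (l - 2)" for l
  define b where "b l = j (l - 2)" for l
  have ab_rng: "{a l, b l} \<subseteq> {1..n+2}" if "l \<in> {3..n+2}" for l
  proof -
    have "l - 2 \<in> {1..n}" using that by auto
    then show ?thesis unfolding a_def b_def using rng by blast
  qed
  define R where "R = {l. (3, l) \<in> (steps {3..n+2} a b)\<^sup>*}"
  define V where "V = R \<inter> {3..n+2}"
  have R_closed: "{a l, b l} \<subseteq> R" if "l \<in> V" for l
    using that unfolding R_def V_def by (auto intro: rtrancl_into_rtrancl simp: steps_def)
  have closed: "{a l, b l} \<subseteq> V \<union> {1, 2}" if "l \<in> V" for l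
  proof
    fix m assume "m \<in> {a l, b l}"
    then have "m \<in> R" "m \<in> {1..n+2}" using R_closed[OF that] ab_rng[of l] that by (auto simp: V_def)
    then show "m \<in> V \<union> {1, 2}" unfolding V_def by auto
  qed
  have r: "3 \<in> V" using n by (auto simp: V_def R_def)
  have root: "(3, l) \<in> (steps V a b)\<^sup>*" if "l \<in> V" for l
  proof -
    have "(3, l) \<in> (steps {3..n+2} a b)\<^sup>*" using that by (simp add: V_def R_def)
    then show ?thesis
    proof (induction rule: rtrancl_induct)
      case (step k l)
      then have "(k, l) \<in> steps V a b" by (auto simp: steps_def V_def R_def)
      then show ?case using step.IH by simp
    qed simp
  qed
  have bound: "real p * z 3 \<le> real q * z 1 + real (p - q) * z 2" if sub: "subharmonic V a b z" for z
  proof -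
    define y where "y l = (if l \<in> V \<union> {1, 2} then exp (z l) else 0)" for l
    have "(y (2 + k))\<^sup>2 \<le> y (i k) * y (j k)" if "k \<in> {1..n}" for k
    proof (cases "2 + k \<in> V")
      case True
      have "2 * z (2 + k) \<le> z (i k) + z (j k)"
        using sub True unfolding subharmonic_def by (force simp: a_def b_def)
      then have "exp (2 * z (2 + k)) \<le> exp (z (i k)) * exp (z (j k))" by (simp flip: exp_add)
      then show ?thesis using closed[OF True] True
        by (simp add: y_def a_def b_def flip: exp_double)
    next
      case False
      then have "y (2 + k) = 0" using that by (simp add: y_def)
      then show ?thesis by (simp add: y_def)
    qed
    then have "y 3 ^ p \<le> y 1 ^ q * y 2 ^ (p - q)"
      by (subst iff) (auto simp: y_def intro!: exI[of _ y])
    then have "exp (real p * z 3) \<le> exp (real q * z 1) * exp (real (p - q) * z 2)"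
      using r by (simp add: y_def exp_of_nat_mult)
    then show ?thesis by (simp flip: exp_add)
  qed
  obtain z where z: "subharmonic V a b z" "z 1 = 1" "z 2 = 0" "z 3 = real q / real p"
  proof -
    \<comment> \<open>A point where the weighted inequality is an equation: the target has the largest value
      that the inequality allows.\<close>
    define x :: "nat \<Rightarrow> real" where "x = (\<lambda>_. 0)(1 := exp 1, 2 := 1, 3 := exp (q / p))"
    have x0: "0 \<le> x l" for l by (simp add: x_def)
    have "x 3 ^ p \<le> x 1 ^ q * x 2 ^ (p - q)"
      using assms(1,2) by (simp add: x_def flip: exp_of_nat_mult)
    then obtain y where y: "\<forall>l\<in>{1..3}. y l = x l" "\<forall>l\<in>{4..n+2}. y l \<ge> 0"
        "\<forall>k\<in>{1..n}. y (i k) * y (j k) \<ge> (y (2 + k))\<^sup>2"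
      using iff[of x] x0 by blast
    have y13: "y 1 = exp 1" "y 2 = 1" "y 3 = exp (q / p)" using y(1) by (auto simp: x_def)
    have y0: "0 \<le> y l" if "l \<in> {1..n+2}" for l
    proof (cases "l \<le> 3")
      case True then show ?thesis using y(1) x0[of l] that by simp
    next
      case False then show ?thesis using y(2) that by auto
    qed
    have ineq: "y (a l) * y (b l) \<ge> (y l)\<^sup>2" if "l \<in> {3..n+2}" for l
    proof -
      have "l - 2 \<in> {1..n}" "2 + (l - 2) = l" using that by auto
      then show ?thesis using y(3) unfolding a_def b_def by metis
    qed
    have pos: "0 < y l" if "l \<in> R" for l
    proof -
      have "(3, l) \<in> (steps {3..n+2} a b)\<^sup>*" using that by (simp add: R_def)
      then show ?thesis
      proof (induction rule: rtrancl_induct)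
        case base
        then show ?case using y13 by simp
      next
        case (step k l)
        then have k: "k \<in> {3..n+2}" "l = a k \<or> l = b k" by (auto simp: steps_def)
        have "0 < (y k)\<^sup>2" using step.IH by simp
        also have "\<dots> \<le> y (a k) * y (b k)" by (rule ineq[OF k(1)])
        finally have "y (a k) \<noteq> 0" "y (b k) \<noteq> 0" by auto
        moreover have "0 \<le> y (a k)" "0 \<le> y (b k)"
          using ab_rng[OF k(1)] by (auto intro: y0)
        ultimately show ?case using k(2) by (auto simp: order_less_le)
      qed
    qed
    have "2 * ln (y l) \<le> ln (y (a l)) + ln (y (b l))" if "l \<in> V" for l
    proof -
      have *: "0 < y l" "0 < y (a l)" "0 < y (b l)" using pos R_closed[OF that] that by (auto simp: V_def)
      have "ln ((y l)\<^sup>2) \<le> ln (y (a l) * y (b l))"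
        using * ineq[of l] that by (subst ln_le_cancel_iff) (auto simp: V_def)
      then show ?thesis using * by (simp add: ln_mult ln_realpow)
    qed
    then show thesis using y13 by (intro that[of "\<lambda>l. ln (y l)"]) (auto simp: subharmonic_def)
  qed
  have disj: "{1, 2} \<inter> V = {}" by (auto simp: V_def)
  have p: "real p > 0" using assms by simp
  have "\<And>z. subharmonic V a b z \<Longrightarrow> \<forall>s\<in>{1,2}. z s = 0 \<Longrightarrow> z 3 \<le> 0"
    using bound p by (fastforce simp: mult_le_0_iff)
  then have reach: "\<exists>s\<in>{1,2}. (k, s) \<in> (steps V a b)\<^sup>*" if "k \<in> V" for k
    using sinks_reachable[OF root disj _ that] by blast
  have "z' 3 \<le> z 3" if "subharmonic V a b z'" "\<forall>s\<in>{1,2}. z' s = z s" for z'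
  proof -
    have "real p * z' 3 \<le> real q" using bound[OF that(1)] that(2) z by simp
    then show ?thesis using z(4) p by (simp add: pos_le_divide_eq mult.commute)
  qed
  then have harm: "2 * z k = z (a k) + z (b k)" if "k \<in> V" for k
    using extremal_is_harmonic[OF root disj z(1) _ that] by blast
  have fin: "finite V" and cop: "coprime p q" and pos: "p > 0"
    using assms by (simp_all add: V_def coprime_iff_gcd_eq_1)
  have ints: "z s \<in> \<int>" if "s \<in> {1, 2}" for s using that z(2,3) by auto
  have "p \<le> 2 ^ card V"
    by (rule harmonic_denominator_le[OF fin r closed harm reach disj ints z(4) pos cop])
  also have "\<dots> \<le> 2 ^ card {3..n+2}"
    by (intro power_increasing card_mono) (auto simp: V_def)
  finally show ?thesis by simp
qed

theorem corollary21:
  fixes p q :: nat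
  assumes "0 < q" and "q < p" and "gcd p q = 1"
  shows "int (L [q, p - q]) = \<lceil>log 2 (real p)\<rceil>"
proof -
  have log_le: "log 2 (real p) \<le> real n \<longleftrightarrow> p \<le> 2 ^ n" for n
  proof -
    have "log 2 (real p) \<le> real n \<longleftrightarrow> real p \<le> 2 ^ n"
      using assms by (simp add: log_le_iff powr_realpow)
    also have "\<dots> \<longleftrightarrow> real p \<le> real (2 ^ n)" by simp
    finally show ?thesis by (simp only: of_nat_le_iff)
  qed
  define n where "n = nat \<lceil>log 2 (real p)\<rceil>"
  have "0 < log 2 (real p)" using assms by simp
  then have n: "int n = \<lceil>log 2 (real p)\<rceil>" "n \<ge> 1" unfolding n_def by linarith+
  have "p \<le> 2 ^ n" using n(1) by (subst log_le[symmetric]) linarith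
  then have "\<exists>i j. simple_soc_rep [q, p - q] n i j"
    using ex_simple_soc_rep[OF assms n(2)] by blast
  moreover have "n \<le> n'" if "\<exists>i j. simple_soc_rep [q, p - q] n' i j" for n'
  proof -
    have "log 2 (real p) \<le> real n'" unfolding log_le using that simple_soc_rep_size[OF assms] by blast
    then show ?thesis using n(1) by linarith
  qed
  ultimately have "L [q, p - q] = n" unfolding L_def by (intro Least_equality)
  then show ?thesis using n(1) by simp
qed

end
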